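(* Let $k,\ell\ge1$ be integers and let $\mathcal{X},\mathcal{Y}$ be finite sets. Let $\mathbf{X}=(X_n)_{n\in\mathbb{N}_0}$ be an $\ell$-th order homogeneous Markov chain on $\mathcal{X}$ with transition matrix $\mathbf{P}$ such that the first-order Markov chain $\mathbf{X}^{(\ell)}=(X_n^{n+\ell-1})_{n\in\mathbb{N}_0}$ on $\mathcal{X}^\ell$ has a single recurrent class and the unique invariant distribution $\pi$. Let $\mathbf{X}^{(\ell)}$ be stationary, i.e., $p_{X_0^{\ell-1}}=\pi$. Let $g:\mathcal{X}\to\mathcal{Y}$ be a function. Define $\mathbf{Y}=(Y_n)_{n\in\mathbb{N}_0}$ by $Y_n=g(X_n)$, and let $\mathbf{Z}$, with transition matrix $\mathbf{Q}$, be the $k$-th order Markov approximation of $\mathbf{Y}$. Then $\mathbf{Z}$ has a unique invariant distribution $\mu$ on $\mathcal{Y}^k$.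
   Context: Notation: $z_a^b=(z_a,\dots,z_b)$, and similarly for random variables; $p_Z(z)=\mathbb{P}(Z=z)$, and $p_{Z_1|Z_2}$ denotes conditional probabilities. Markov chains: A $k$-th order homogeneous Markov chain $\mathbf{Z}=(Z_n)_{n\in\mathbb{N}_0}$ on a finite alphabet $\mathcal{Z}$ with transition matrix $\mathbf{Q}$ (a $|\mathcal{Z}|^k\times|\mathcal{Z}|$ row-stochastic matrix with entries $Q_{z_0^{k-1}\to z_k}$) is a process with $p_{Z_n|Z_0^{n-1}}(z_n|z_0^{n-1})=p_{Z_n|Z_{n-k}^{n-1}}(z_n|z_{n-k}^{n-1})=Q_{z_{n-k}^{n-1}\to z_n}$ for all $n\ge k$ and all $z_0^n\in\mathcal{Z}^{n+1}$. Lifted chain: For such a chain, $\mathbf{Z}^{(k)}=(Z_n^{n+k-1})_{n\in\mathbb{N}_0}$ is the first-order homogeneous Markov chain on $\mathcal{Z}^k$ whose transition probability from ${z'}_0^{k-1}$ to $z_0^{k-1}$ equals $Q_{{z'}_0^{k-1}\to z_{k-1}}$ if $z'_1=z_0,\dots,z'_{k-1}=z_{k-2}$, and $0$ otherwise. Recurrent classes of a first-order chain: $z$ is accessible from $z'$ ($z'\to z$) if some $n\ge1$ has $n$-step transition probability from $z'$ to $z$ positive; $z,z'$ communicate if $z\to z'$ and $z'\to z$; $z$ is recurrent if $z\to z'$ implies $z'\to z$, and transient otherwise; a recurrent class is a communication class of recurrent states. Invariant distribution: A probability distribution $\mu$ on $\mathcal{Z}^k$ is invariant for a $k$-th order chain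 with transition matrix $\mathbf{Q}$ if and only if for all $z_1^k\in\mathcal{Z}^k$: $\mu_{z_1^k}=\sum_{z_0\in\mathcal{Z}}\mu_{z_0^{k-1}}Q_{z_0^{k-1}\to z_k}$. Markov approximation: For a stationary process $\mathbf{W}$ on a finite alphabet $\mathcal{Z}$, its $k$-th order Markov approximation is a $k$-th order homogeneous Markov chain on $\mathcal{Z}$ with transition matrix $\mathbf{Q}$ given, for all $z_0^k\in\mathcal{Z}^{k+1}$, by $Q_{z_0^{k-1}\to z_k}=p_{W_0^k}(z_0^k)/p_{W_0^{k-1}}(z_0^{k-1})$ if $p_{W_0^{k-1}}(z_0^{k-1})>0$, and $Q_{z_0^{k-1}\to z_k}=1/|\mathcal{Z}|$ otherwise. *)

theory Defs
  imports "HOL-Probability.Probability"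
begin

abbreviation words :: "'z set \<Rightarrow> nat \<Rightarrow> 'z list set" where
  "words S n \<equiv> {w. set w \<subseteq> S \<and> length w = n}"

text \<open>
  \<open>window Z m n\<close> is the random word $(Z_m,\dots,Z_{n-1})$; the right end is excluded.
\<close>

definition window :: "(nat \<Rightarrow> 'a \<Rightarrow> 'z) \<Rightarrow> nat \<Rightarrow> nat \<Rightarrow> 'a \<Rightarrow> 'z list" where
  "window Z m n \<omega> = map (\<lambda>i. Z i \<omega>) [m..<n]"

definition row_stochastic :: "nat \<Rightarrow> 'z set \<Rightarrow> ('z list \<Rightarrow> 'z \<Rightarrow> real) \<Rightarrow> bool" where
  "row_stochastic k S Q \<longleftrightarrow>
     (\<forall>w\<in>words S k. (\<forall>a\<in>S. 0 \<le> Q w a) \<and> (\<Sum>a\<in>S. Q w a) = 1)"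

text \<open>
  The two Markov identities are only required for pasts of positive probability, since
  \<open>cond_prob\<close> is $0$ by convention when the conditioning event is null. The initial
  distribution is unconstrained.
\<close>

definition homogeneous_markov_chain ::
    "'a measure \<Rightarrow> nat \<Rightarrow> 'z set \<Rightarrow> (nat \<Rightarrow> 'a \<Rightarrow> 'z) \<Rightarrow> ('z list \<Rightarrow> 'z \<Rightarrow> real) \<Rightarrow> bool" where
  "homogeneous_markov_chain M k S Z Q \<longleftrightarrow>
     prob_space M \<and>
     (\<forall>n. Z n \<in> measurable M (count_space S)) \<and>
     row_stochastic k S Q \<and>
     (\<forall>n\<ge>k. \<forall>w\<in>words S n. \<forall>a\<in>S.
        \<P>(\<omega> in M. window Z 0 n \<omega> = w) > 0 \<longrightarrow>
          \<P>(\<omega> in M. Z n \<omega> = a \<bar> window Z 0 n \<omega> = w)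
            = \<P>(\<omega> in M. Z n \<omega> = a \<bar> window Z (n - k) n \<omega> = drop (n - k) w) \<and>
          \<P>(\<omega> in M. Z n \<omega> = a \<bar> window Z (n - k) n \<omega> = drop (n - k) w)
            = Q (drop (n - k) w) a)"

text \<open>
  A word $v = z'_0\dots z'_{k-1}$ moves to $w = z_0\dots z_{k-1}$ only if
  $z'_1\dots z'_{k-1} = z_0\dots z_{k-2}$.
\<close>

definition lifted_transition :: "('z list \<Rightarrow> 'z \<Rightarrow> real) \<Rightarrow> 'z list \<Rightarrow> 'z list \<Rightarrow> real" where
  "lifted_transition Q v w = (if tl v = butlast w then Q v (last w) else 0)"

fun n_step :: "'s set \<Rightarrow> ('s \<Rightarrow> 's \<Rightarrow> real) \<Rightarrow> nat \<Rightarrow> 's \<Rightarrow> 's \<Rightarrow> real" where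
  "n_step S T 0 x y = (if x = y then 1 else 0)"
| "n_step S T (Suc n) x y = (\<Sum>u\<in>S. T x u * n_step S T n u y)"

definition accessible :: "'s set \<Rightarrow> ('s \<Rightarrow> 's \<Rightarrow> real) \<Rightarrow> 's \<Rightarrow> 's \<Rightarrow> bool" where
  "accessible S T x y \<longleftrightarrow> (\<exists>n\<ge>1. n_step S T n x y > 0)"

definition communicate :: "'s set \<Rightarrow> ('s \<Rightarrow> 's \<Rightarrow> real) \<Rightarrow> 's \<Rightarrow> 's \<Rightarrow> bool" where
  "communicate S T x y \<longleftrightarrow> accessible S T x y \<and> accessible S T y x"

definition recurrent :: "'s set \<Rightarrow> ('s \<Rightarrow> 's \<Rightarrow> real) \<Rightarrow> 's \<Rightarrow> bool" where
  "recurrent S T x \<longleftrightarrow> (\<forall>y\<in>S. accessible S T x y \<longrightarrow> accessible S T y x)"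

text \<open>
  A recurrent state of a finite stochastic matrix communicates with itself, so the communication
  relation is an equivalence relation on the recurrent states although it need not be reflexive
  on \<open>S\<close>.
\<close>

definition recurrent_classes :: "'s set \<Rightarrow> ('s \<Rightarrow> 's \<Rightarrow> real) \<Rightarrow> 's set set" where
  "recurrent_classes S T =
     {x\<in>S. recurrent S T x} // {(x, y). x \<in> S \<and> y \<in> S \<and> communicate S T x y}"

definition invariant_distribution_first_order ::
    "'s set \<Rightarrow> ('s \<Rightarrow> 's \<Rightarrow> real) \<Rightarrow> 's pmf \<Rightarrow> bool" where
  "invariant_distribution_first_order S T \<mu> \<longleftrightarrow>
     set_pmf \<mu> \<subseteq> S \<and> (\<forall>y\<in>S. pmf \<mu> y = (\<Sum>x\<in>S. pmf \<mu> x * T x y))"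

text \<open>
  For $w = z_1\dots z_k$ and $a = z_0$, the word \<open>a # butlast w\<close> is $z_0\dots z_{k-1}$.
  This uses $k \ge 1$.
\<close>

definition invariant_distribution ::
    "nat \<Rightarrow> 'z set \<Rightarrow> ('z list \<Rightarrow> 'z \<Rightarrow> real) \<Rightarrow> 'z list pmf \<Rightarrow> bool" where
  "invariant_distribution k S Q \<mu> \<longleftrightarrow>
     set_pmf \<mu> \<subseteq> words S k \<and>
     (\<forall>w\<in>words S k.
        pmf \<mu> w = (\<Sum>a\<in>S. pmf \<mu> (a # butlast w) * Q (a # butlast w) (last w)))"

text \<open>
  The chain \<open>Z\<close> may live on a probability space \<open>N\<close> different from that of \<open>W\<close>. The notion is
  meant for stationary \<open>W\<close>; stationarity is left to the user of the definition.
\<close>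

definition markov_approximation ::
    "'a measure \<Rightarrow> (nat \<Rightarrow> 'a \<Rightarrow> 'z) \<Rightarrow> nat \<Rightarrow> 'z set \<Rightarrow>
     'b measure \<Rightarrow> (nat \<Rightarrow> 'b \<Rightarrow> 'z) \<Rightarrow> ('z list \<Rightarrow> 'z \<Rightarrow> real) \<Rightarrow> bool" where
  "markov_approximation M W k S N Z Q \<longleftrightarrow>
     homogeneous_markov_chain N k S Z Q \<and>
     (\<forall>w\<in>words S k. \<forall>a\<in>S.
        Q w a = (if \<P>(\<omega> in M. window W 0 k \<omega> = w) > 0
                 then \<P>(\<omega> in M. window W 0 (Suc k) \<omega> = w @ [a]) / \<P>(\<omega> in M. window W 0 k \<omega> = w)
                 else 1 / card S))"

end

theory Submission
  imports Defs
begin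

text \<open>
  Write \<open>p(w)\<close> for the probability that a process starts with the word \<open>w\<close>.

  Existence. \<open>Y\<close> inherits stationarity from \<open>X\<close>, and \<open>p(w) Q(w, a) = p(wa)\<close> for every word
  \<open>w\<close> of length \<open>k\<close>: this is the definition of \<open>Q\<close> if \<open>p(w) > 0\<close>, and otherwise both sides vanish.
  Summing over the first letter shows that the law of the first \<open>k\<close> letters of \<open>Y\<close> is invariant
  (\<open>invariant_distribution_exists\<close>).

  Uniqueness. A finite stochastic matrix has at most one invariant distribution as soon as some
  state can be reached from all others (\<open>invariant_unique\<close>): the positive and the
  negative part of the difference of two invariant distributions are both invariant, both would
  be nonzero, and hence both would charge that state. So it is enough to
  connect every word of length \<open>k\<close> to one fixed word \<open>v\<close> with \<open>p(v) > 0\<close> in the lifted chain of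
  \<open>Q\<close>.

  A word of probability zero has a uniform row in \<open>Q\<close>, so from it the letters of \<open>v\<close> can be appended
  one by one until a word of positive probability appears, at the latest \<open>v\<close> itself
  (\<open>reaches_positive_word\<close>). From a word \<open>u\<close> of positive probability, \<open>v\<close> is reached because
  \<open>p(ucv) > 0\<close> for some word \<open>c\<close>: sliding a window of length \<open>k\<close> along \<open>ucv\<close> only meets factors of
  positive probability, hence only positive entries of \<open>Q\<close> (\<open>positive_word_gives_path\<close>).

  The existence of such a connecting word, called irreducibility of the language below, passes
  from \<open>X\<close> to its letterwise image \<open>Y\<close> at once. For \<open>X\<close> it comes from the uniqueness of \<open>\<pi>\<close>. The states
  reachable from a state \<open>s\<close> in the support of \<open>\<pi>\<close> form a closed set, so conditioning \<open>\<pi>\<close> on this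
  set gives an invariant distribution again; this must be \<open>\<pi>\<close>, and so the whole support is reachable
  from \<open>s\<close> (\<open>support_strongly_connected\<close>). Words of positive probability can be glued
  along such paths because of the Markov property (\<open>irreducible_if_unique\<close>). Working with
  words instead of states makes the argument insensitive to how \<open>k\<close> compares with the order of \<open>X\<close>.
\<close>

section \<open>Invariant functions of a finite stochastic matrix\<close>

locale finite_stochastic_matrix =
  fixes S :: "'s set" and T :: "'s \<Rightarrow> 's \<Rightarrow> real"
  assumes finite_S: "finite S"
    and nonneg: "\<And>x y. x \<in> S \<Longrightarrow> y \<in> S \<Longrightarrow> 0 \<le> T x y"
    and row_sum: "\<And>x. x \<in> S \<Longrightarrow> (\<Sum>y\<in>S. T x y) = 1"
begin

definition positive_steps :: "'s rel" where
  "positive_steps = {(x, y). x \<in> S \<and> y \<in> S \<and> 0 < T x y}"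

definition invariant :: "('s \<Rightarrow> real) \<Rightarrow> bool" where
  "invariant f \<longleftrightarrow> (\<forall>y\<in>S. f y = (\<Sum>x\<in>S. f x * T x y))"

lemma total_mass_preserved: "(\<Sum>y\<in>S. \<Sum>x\<in>S. f x * T x y) = (\<Sum>x\<in>S. f x)"
proof -
  have "(\<Sum>y\<in>S. \<Sum>x\<in>S. f x * T x y) = (\<Sum>x\<in>S. \<Sum>y\<in>S. f x * T x y)"
    by (rule sum.swap)
  also have "\<dots> = (\<Sum>x\<in>S. f x)"
    by (simp add: sum_distrib_left[symmetric] row_sum)
  finally show ?thesis .
qed

text \<open>
  One application of \<open>T\<close> preserves the total mass, so it cannot lower \<open>f\<close> anywhere if it raises it
  nowhere.
\<close>

lemma superinvariant_imp_invariant: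
  assumes "\<And>y. y \<in> S \<Longrightarrow> (\<Sum>x\<in>S. f x * T x y) \<le> f y"
  shows "invariant f"
  unfolding invariant_def
proof (rule ccontr)
  assume "\<not> (\<forall>y\<in>S. f y = (\<Sum>x\<in>S. f x * T x y))"
  then obtain y where "y \<in> S" "(\<Sum>x\<in>S. f x * T x y) < f y"
    using assms by (metis order_le_less)
  then have "(\<Sum>y\<in>S. \<Sum>x\<in>S. f x * T x y) < (\<Sum>y\<in>S. f y)"
    using assms finite_S by (intro sum_strict_mono_ex1) auto
  then show False by (simp add: total_mass_preserved)
qed

lemma invariant_lincomb:
  assumes "invariant f" "invariant h"
  shows "invariant (\<lambda>x. a * f x + b * h x)"
proof -
  have "a * f y + b * h y = (\<Sum>x\<in>S. (a * f x + b * h x) * T x y)" if "y \<in> S" for y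
  proof -
    have "a * f y + b * h y = a * (\<Sum>x\<in>S. f x * T x y) + b * (\<Sum>x\<in>S. h x * T x y)"
      using assms that by (simp add: invariant_def)
    also have "\<dots> = (\<Sum>x\<in>S. (a * f x + b * h x) * T x y)"
      by (simp add: sum_distrib_left sum.distrib distrib_right mult.assoc)
    finally show ?thesis .
  qed
  then show ?thesis by (simp add: invariant_def)
qed

text \<open>
  This is how invariant functions are split into positive and negative parts: the triangle inequality
  gives one of the two inequalities between \<open>\<bar>f\<bar>\<close> and its image under \<open>T\<close>, and conservation of
  mass turns it into an equality.
\<close>

lemma invariant_abs:
  assumes "invariant f"
  shows "invariant (\<lambda>x. \<bar>f x\<bar>)"
proof -
  have "invariant (\<lambda>x. - \<bar>f x\<bar>)"
  proof (rule superinvariant_imp_invariant)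
    fix y assume "y \<in> S"
    have "\<bar>f y\<bar> = \<bar>\<Sum>x\<in>S. f x * T x y\<bar>"
      using assms \<open>y \<in> S\<close> by (simp add: invariant_def)
    also have "\<dots> \<le> (\<Sum>x\<in>S. \<bar>f x * T x y\<bar>)"
      by (rule sum_abs)
    also have "\<dots> = (\<Sum>x\<in>S. \<bar>f x\<bar> * T x y)"
      using nonneg \<open>y \<in> S\<close> by (intro sum.cong) (auto simp: abs_mult)
    finally show "(\<Sum>x\<in>S. - \<bar>f x\<bar> * T x y) \<le> - \<bar>f y\<bar>"
      by (simp add: sum_negf)
  qed
  from invariant_lincomb[OF this this, of "-1" 0] show ?thesis by simp
qed

lemma invariant_positive_propagates:
  assumes "invariant f" and "\<And>x. x \<in> S \<Longrightarrow> 0 \<le> f x"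
    and "(x, y) \<in> positive_steps\<^sup>*" and "0 < f x"
  shows "0 < f y"
  using assms(3,4)
proof (induction rule: rtrancl_induct)
  case (step y z)
  then have yz: "y \<in> S" "z \<in> S" "0 < T y z" "0 < f y"
    by (auto simp: positive_steps_def)
  have "0 < f y * T y z" using yz by simp
  also have "\<dots> \<le> (\<Sum>x\<in>S. f x * T x z)"
    using yz assms(2) nonneg finite_S
    by (intro member_le_sum[where f = "\<lambda>x. f x * T x z"]) auto
  also have "\<dots> = f z" using assms(1) yz by (simp add: invariant_def)
  finally show ?case .
qed

text \<open>
  Were the two functions different, their difference \<open>d\<close> would be positive somewhere and negative
  somewhere. Positivity of \<open>\<bar>d\<bar> + d\<close> and of \<open>\<bar>d\<bar> - d\<close> would then both
  propagate to the common state \<open>v\<close>, but at each state one of them is zero.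
\<close>

lemma invariant_unique:
  assumes root: "\<And>x. x \<in> S \<Longrightarrow> (x, v) \<in> positive_steps\<^sup>*"
    and "invariant f" "invariant h" and sums: "sum f S = sum h S" and "x \<in> S"
  shows "f x = h x"
proof (rule ccontr)
  define d where "d = (\<lambda>x. f x - h x)"
  have inv: "invariant d"
    using invariant_lincomb[OF assms(2,3), of 1 "-1"] by (simp add: d_def)
  have pos: "invariant (\<lambda>x. \<bar>d x\<bar> + d x)" and neg: "invariant (\<lambda>x. \<bar>d x\<bar> - d x)"
    using invariant_lincomb[OF invariant_abs[OF inv] inv, of 1 1]
      invariant_lincomb[OF invariant_abs[OF inv] inv, of 1 "-1"] by simp_all
  have zero: "sum d S = 0"
    using sums by (simp add: d_def sum_subtractf)
  assume "f x \<noteq> h x"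
  then have "d x \<noteq> 0" by (simp add: d_def)
  \<comment> \<open>As \<open>d\<close> has total mass 0, it takes values of both signs.\<close>
  have "\<exists>a\<in>S. 0 < d a"
  proof (rule ccontr)
    assume "\<not> ?thesis"
    then have "\<And>a. a \<in> S \<Longrightarrow> 0 \<le> - d a" by force
    with zero have "\<forall>a\<in>S. - d a = 0"
      using sum_nonneg_eq_0_iff[OF finite_S, of "\<lambda>a. - d a"] by (simp add: sum_negf)
    with \<open>d x \<noteq> 0\<close> \<open>x \<in> S\<close> show False by simp
  qed
  then obtain a where a: "a \<in> S" "0 < d a" by blast
  have "\<exists>b\<in>S. d b < 0"
  proof (rule ccontr)
    assume "\<not> ?thesis"
    then have "\<And>a. a \<in> S \<Longrightarrow> 0 \<le> d a" by force
    with zero have "\<forall>a\<in>S. d a = 0"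
      using sum_nonneg_eq_0_iff[OF finite_S, of d] by simp
    with \<open>d x \<noteq> 0\<close> \<open>x \<in> S\<close> show False by simp
  qed
  then obtain b where b: "b \<in> S" "d b < 0" by blast
  have "0 < \<bar>d v\<bar> + d v"
    using invariant_positive_propagates[OF pos _ root[OF a(1)]] a(2) by simp
  moreover have "0 < \<bar>d v\<bar> - d v"
    using invariant_positive_propagates[OF neg _ root[OF b(1)]] b(2) by simp
  ultimately show False by linarith
qed

lemma invariant_distribution_first_order_iff:
  "invariant_distribution_first_order S T \<mu> \<longleftrightarrow> set_pmf \<mu> \<subseteq> S \<and> invariant (pmf \<mu>)"
  by (simp add: invariant_distribution_first_order_def invariant_def)

lemma invariant_distribution_first_order_unique:
  assumes "\<And>x. x \<in> S \<Longrightarrow> (x, v) \<in> positive_steps\<^sup>*"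
    and "invariant_distribution_first_order S T \<mu>" "invariant_distribution_first_order S T \<nu>"
  shows "\<mu> = \<nu>"
proof (rule pmf_eqI)
  fix x
  have "sum (pmf \<mu>) S = sum (pmf \<nu>) S"
    using assms(2,3) finite_S by (simp add: invariant_distribution_first_order_iff sum_pmf_eq_1)
  then show "pmf \<mu> x = pmf \<nu> x"
    using invariant_unique[OF assms(1), of "pmf \<mu>" "pmf \<nu>" x] assms(2,3)
    unfolding invariant_distribution_first_order_iff by (metis set_pmf_iff subsetD)
qed

text \<open>
  The set \<open>C\<close> of states reachable from \<open>x\<close> is closed, so restricting \<open>\<pi>\<close> to \<open>C\<close> yields a
  superinvariant, hence invariant, function. By uniqueness the normalised restriction is \<open>\<pi>\<close> itself,
  that is, the support of \<open>\<pi>\<close> lies in \<open>C\<close>.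
\<close>

lemma support_strongly_connected:
  assumes inv: "invariant_distribution_first_order S T \<pi>"
    and unique: "\<And>\<pi>'. invariant_distribution_first_order S T \<pi>' \<Longrightarrow> \<pi>' = \<pi>"
    and x: "x \<in> set_pmf \<pi>" and y: "y \<in> set_pmf \<pi>"
  shows "(x, y) \<in> positive_steps\<^sup>*"
proof -
  define C where "C = positive_steps\<^sup>* `` {x}"
  have xC: "x \<in> C" by (simp add: C_def)
  have leave: "T u w = 0" if "u \<in> C" "u \<in> S" "w \<in> S" "w \<notin> C" for u w
  proof (rule ccontr)
    assume "T u w \<noteq> 0"
    with that nonneg have "(u, w) \<in> positive_steps"
      by (force simp: positive_steps_def less_le)
    with that show False
      by (auto simp: C_def intro: rtrancl_into_rtrancl)
  qed
  define h where "h = (\<lambda>u. if u \<in> C then pmf \<pi> u else 0)"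
  have inv_pi: "invariant (pmf \<pi>)" and supp: "set_pmf \<pi> \<subseteq> S"
    using inv by (auto simp: invariant_distribution_first_order_iff)
  have inv_h: "invariant h"
  proof (rule superinvariant_imp_invariant)
    fix w assume w: "w \<in> S"
    show "(\<Sum>u\<in>S. h u * T u w) \<le> h w"
    proof (cases "w \<in> C")
      case True
      have "(\<Sum>u\<in>S. h u * T u w) \<le> (\<Sum>u\<in>S. pmf \<pi> u * T u w)"
        using w nonneg by (intro sum_mono mult_right_mono) (auto simp: h_def)
      with True w inv_pi show ?thesis by (simp add: h_def invariant_def)
    next
      case False
      then have "(\<Sum>u\<in>S. h u * T u w) = 0"
        using w leave by (intro sum.neutral) (auto simp: h_def)
      with False show ?thesis by (simp add: h_def)
    qed
  qed
  have meets: "set_pmf \<pi> \<inter> C \<noteq> {}" using x xC by blast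
  define c where "c = measure (measure_pmf \<pi>) C"
  \<comment> \<open>The second summand is zero; this is the shape of \<open>invariant_lincomb\<close>.\<close>
  have cond: "pmf (cond_pmf \<pi> C) = (\<lambda>u. inverse c * h u + 0 * h u)"
    using pmf_cond[OF meets] by (auto simp: h_def c_def divide_inverse)
  have "invariant_distribution_first_order S T (cond_pmf \<pi> C)"
    using supp set_cond_pmf[OF meets] invariant_lincomb[OF inv_h inv_h, of "inverse c" 0]
    unfolding invariant_distribution_first_order_iff cond by auto
  then have "cond_pmf \<pi> C = \<pi>" by (rule unique)
  then have "set_pmf \<pi> \<subseteq> C" using set_cond_pmf[OF meets] by auto
  with y show ?thesis by (auto simp: C_def)
qed

end

section \<open>The lifted chain on words\<close>

lemma finite_words: "finite S \<Longrightarrow> finite (words S n)"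
  by (rule finite_lists_length_eq)

lemma finite_words_Collect: "finite S \<Longrightarrow> finite {w. w \<in> words S n \<and> \<phi> w}"
  by (rule finite_subset[OF _ finite_words[of S n]]) auto

lemma words_with_tail:
  assumes "u \<in> words S n"
  shows "{v \<in> words S (Suc n). tl v = u} = (\<lambda>a. a # u) ` S"
proof -
  have "v \<in> (\<lambda>a. a # u) ` S" if "v \<in> words S (Suc n)" "tl v = u" for v
    using that by (cases v) auto
  then show ?thesis using assms by auto
qed

lemma words_with_initial_part:
  assumes "u \<in> words S n"
  shows "{v \<in> words S (Suc n). butlast v = u} = (\<lambda>a. u @ [a]) ` S"
proof -
  have "v \<in> (\<lambda>a. u @ [a]) ` S" if "v \<in> words S (Suc n)" "butlast v = u" for v
    using that by (cases v rule: rev_cases) auto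
  then show ?thesis using assms by auto
qed

lemma sum_over_heads:
  assumes "finite S" "u \<in> words S n"
  shows "(\<Sum>v | v \<in> words S (Suc n) \<and> tl v = u. f v) = (\<Sum>a\<in>S. f (a # u))"
  using words_with_tail[OF assms(2)] by (simp add: sum.reindex inj_on_def)

lemma sum_over_lasts:
  assumes "finite S" "u \<in> words S n"
  shows "(\<Sum>v | v \<in> words S (Suc n) \<and> butlast v = u. f v) = (\<Sum>a\<in>S. f (u @ [a]))"
  using words_with_initial_part[OF assms(2)] by (simp add: sum.reindex inj_on_def)

lemma tl_in_words: "w \<in> words S (Suc n) \<Longrightarrow> tl w \<in> words S n"
  by (cases w) auto

lemma butlast_in_words: "w \<in> words S (Suc n) \<Longrightarrow> butlast w \<in> words S n"
  by (auto dest: in_set_butlastD)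

text \<open>
  The only predecessors of \<open>w\<close> in the lifted chain are the words \<open>a # butlast w\<close>, which is why the
  invariance equation of a chain of order \<open>k\<close> has one summand per letter.
\<close>

lemma sum_lifted_transition:
  assumes "finite S" "k \<ge> 1" "w \<in> words S k"
  shows "(\<Sum>v\<in>words S k. f v * lifted_transition Q v w)
           = (\<Sum>a\<in>S. f (a # butlast w) * Q (a # butlast w) (last w))"
proof -
  obtain n where k: "k = Suc n" using assms(2) by (cases k) auto
  have "(\<Sum>v\<in>words S k. f v * lifted_transition Q v w)
      = (\<Sum>v\<in>words S k. if tl v = butlast w then f v * Q v (last w) else 0)"
    by (intro sum.cong) (auto simp: lifted_transition_def)
  also have "\<dots> = (\<Sum>v | v \<in> words S k \<and> tl v = butlast w. f v * Q v (last w))"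
    by (subst sum.inter_filter[OF finite_words[OF assms(1)], symmetric]) simp
  also have "\<dots> = (\<Sum>a\<in>S. f (a # butlast w) * Q (a # butlast w) (last w))"
    using sum_over_heads[OF assms(1) butlast_in_words] assms(3) unfolding k by blast
  finally show ?thesis .
qed

lemma invariant_distribution_iff_lifted:
  assumes "finite S" "k \<ge> 1"
  shows "invariant_distribution k S Q \<mu> \<longleftrightarrow>
           invariant_distribution_first_order (words S k) (lifted_transition Q) \<mu>"
  unfolding invariant_distribution_def invariant_distribution_first_order_def
  using sum_lifted_transition[OF assms] by simp

lemma finite_stochastic_matrix_lifted:
  assumes "finite S" "k \<ge> 1" "row_stochastic k S Q"
  shows "finite_stochastic_matrix (words S k) (lifted_transition Q)"
proof
  obtain n where k: "k = Suc n" using assms(2) by (cases k) auto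
  show "finite (words S k)" using assms(1) by (rule finite_words)
  show "0 \<le> lifted_transition Q v w" if "v \<in> words S k" "w \<in> words S k" for v w
  proof -
    have "last w \<in> S" using that(2) k by (cases w rule: rev_cases) auto
    then show ?thesis
      using assms(3) that(1) by (auto simp: lifted_transition_def row_stochastic_def)
  qed
  show "(\<Sum>w\<in>words S k. lifted_transition Q v w) = 1" if v: "v \<in> words S k" for v
  proof -
    have "(\<Sum>w\<in>words S k. lifted_transition Q v w)
        = (\<Sum>w\<in>words S k. if butlast w = tl v then Q v (last w) else 0)"
      by (intro sum.cong) (auto simp: lifted_transition_def)
    also have "\<dots> = (\<Sum>w | w \<in> words S k \<and> butlast w = tl v. Q v (last w))"
      by (subst sum.inter_filter[OF finite_words[OF assms(1)], symmetric]) simp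
    also have "\<dots> = (\<Sum>a\<in>S. Q v a)"
      using sum_over_lasts[OF assms(1) tl_in_words, of v n "\<lambda>w. Q v (last w)"] v
      unfolding k by simp
    also have "\<dots> = 1" using assms(3) v by (simp add: row_stochastic_def)
    finally show ?thesis .
  qed
qed

section \<open>Word probabilities of a process\<close>

definition word_prob :: "'a measure \<Rightarrow> (nat \<Rightarrow> 'a \<Rightarrow> 'z) \<Rightarrow> 'z list \<Rightarrow> real" where
  "word_prob M W w = \<P>(\<omega> in M. window W 0 (length w) \<omega> = w)"

lemma length_window: "length (window W m n \<omega>) = n - m"
  by (simp add: window_def)

lemma window_Suc: "m \<le> n \<Longrightarrow> window W m (Suc n) \<omega> = window W m n \<omega> @ [W n \<omega>]"
  by (simp add: window_def)

lemma tl_window: "tl (window W m n \<omega>) = window W (Suc m) n \<omega>"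
  by (cases "m < n") (simp_all add: window_def upt_conv_Cons)

lemma butlast_window: "butlast (window W m (Suc n) \<omega>) = window W m n \<omega>"
  by (simp add: window_def map_butlast[symmetric])

lemma take_window: "take i (window W 0 (i + j) \<omega>) = window W 0 i \<omega>"
  by (simp add: window_def take_map)

locale finite_alphabet_process = prob_space M
  for M :: "'a measure" +
  fixes S :: "'z set" and W :: "nat \<Rightarrow> 'a \<Rightarrow> 'z"
  assumes finite_S: "finite S"
    and W_measurable: "\<And>n. W n \<in> measurable M (count_space S)"
begin

lemma W_in_S: "\<omega> \<in> space M \<Longrightarrow> W n \<omega> \<in> S"
  using measurable_space[OF W_measurable] by simp

lemma window_in_words: "\<omega> \<in> space M \<Longrightarrow> window W m n \<omega> \<in> words S (n - m)"
  by (auto simp: window_def W_in_S)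

lemma window_measurable: "window W m n \<in> measurable M (count_space (words S (n - m)))"
proof (subst measurable_count_space_eq2[OF finite_words[OF finite_S]], intro conjI ballI)
  show "window W m n \<in> space M \<rightarrow> words S (n - m)"
    using window_in_words by blast
  fix w assume w: "w \<in> words S (n - m)"
  have meas: "{\<omega> \<in> space M. W (m + i) \<omega> = w ! i} \<in> sets M" if "i < length w" for i
  proof -
    have "w ! i \<in> S" using w that by auto
    then have "W (m + i) -` {w ! i} \<inter> space M \<in> sets M"
      by (intro measurable_sets[OF W_measurable]) auto
    then show ?thesis by (simp add: vimage_def Int_def conj_commute)
  qed
  have "window W m n -` {w} \<inter> space M = {\<omega> \<in> space M. \<forall>i\<in>{..<length w}. W (m + i) \<omega> = w ! i}"
    using w by (auto simp: window_def list_eq_iff_nth_eq)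
  also have "\<dots> \<in> sets M"
    using meas by (intro sets.sets_Collect_finite_All) auto
  finally show "window W m n -` {w} \<inter> space M \<in> sets M" .
qed

lemma window_event: "{\<omega> \<in> space M. \<phi> (window W m n \<omega>)} \<in> sets M"
proof -
  have "window W m n -` ({w. \<phi> w} \<inter> words S (n - m)) \<inter> space M \<in> sets M"
    by (intro measurable_sets[OF window_measurable]) auto
  also have "window W m n -` ({w. \<phi> w} \<inter> words S (n - m)) \<inter> space M
      = {\<omega> \<in> space M. \<phi> (window W m n \<omega>)}"
    using window_in_words[of _ m n] by auto
  finally show ?thesis .
qed

lemma window_prob_sum:
  "\<P>(\<omega> in M. \<phi> (window W m n \<omega>))
     = (\<Sum>w | w \<in> words S (n - m) \<and> \<phi> w. \<P>(\<omega> in M. window W m n \<omega> = w))"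
proof -
  let ?F = "{w \<in> words S (n - m). \<phi> w}"
  have "{\<omega> \<in> space M. \<phi> (window W m n \<omega>)} = (\<Union>w\<in>?F. {\<omega> \<in> space M. window W m n \<omega> = w})"
    using window_in_words[of _ m n] by auto
  also have "prob \<dots> = (\<Sum>w\<in>?F. prob {\<omega> \<in> space M. window W m n \<omega> = w})"
    using window_event[of "\<lambda>v. v = _"]
    by (intro finite_measure_finite_Union finite_words_Collect[OF finite_S])
      (auto simp: disjoint_family_on_def)
  finally show ?thesis by simp
qed

lemma word_prob_nonneg: "0 \<le> word_prob M W w"
  by (simp add: word_prob_def)

lemma word_prob_posD: "0 < word_prob M W w \<Longrightarrow> set w \<subseteq> S"
proof (rule ccontr)
  assume "\<not> set w \<subseteq> S"
  then have "{\<omega> \<in> space M. window W 0 (length w) \<omega> = w} = {}"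
    using window_in_words[of _ 0 "length w"] by force
  moreover assume "0 < word_prob M W w"
  ultimately show False unfolding word_prob_def by (metis measure_empty less_irrefl)
qed

lemma sum_word_prob:
  "\<P>(\<omega> in M. \<phi> (window W 0 n \<omega>)) = (\<Sum>w | w \<in> words S n \<and> \<phi> w. word_prob M W w)"
  by (subst window_prob_sum) (auto intro!: sum.cong simp: word_prob_def)

lemma word_prob_prefix: "word_prob M W (u @ v) \<le> word_prob M W u"
  unfolding word_prob_def
proof (rule finite_measure_mono)
  show "{\<omega> \<in> space M. window W 0 (length (u @ v)) \<omega> = u @ v}
      \<subseteq> {\<omega> \<in> space M. window W 0 (length u) \<omega> = u}"
  proof safe
    fix \<omega> assume "window W 0 (length (u @ v)) \<omega> = u @ v"
    then have "take (length u) (window W 0 (length u + length v) \<omega>) = u" by simp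
    then show "window W 0 (length u) \<omega> = u" by (simp only: take_window)
  qed
qed (rule window_event)

lemma word_prob_prefix_pos: "0 < word_prob M W (u @ v) \<Longrightarrow> 0 < word_prob M W u"
  using word_prob_prefix[of u v] by linarith

lemma sum_word_prob_snoc:
  assumes "set w \<subseteq> S"
  shows "(\<Sum>a\<in>S. word_prob M W (w @ [a])) = word_prob M W w"
proof -
  have "word_prob M W w = \<P>(\<omega> in M. butlast (window W 0 (Suc (length w)) \<omega>) = w)"
    by (simp add: word_prob_def butlast_window)
  also have "\<dots> = (\<Sum>v | v \<in> words S (Suc (length w)) \<and> butlast v = w. word_prob M W v)"
    by (rule sum_word_prob)
  also have "\<dots> = (\<Sum>a\<in>S. word_prob M W (w @ [a]))"
    using assms finite_S by (intro sum_over_lasts) auto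
  finally show ?thesis by simp
qed

lemma extend_word_pos:
  assumes "0 < word_prob M W w"
  shows "\<exists>s. length s = n \<and> 0 < word_prob M W (w @ s)"
proof (induction n)
  case 0
  with assms show ?case by simp
next
  case (Suc n)
  then obtain s where s: "length s = n" "0 < word_prob M W (w @ s)" by blast
  have "\<exists>a\<in>S. 0 < word_prob M W ((w @ s) @ [a])"
  proof (rule ccontr)
    assume "\<not> ?thesis"
    then have "(\<Sum>a\<in>S. word_prob M W ((w @ s) @ [a])) \<le> 0"
      by (intro sum_nonpos) (auto simp: not_less)
    with s show False
      using sum_word_prob_snoc[of "w @ s"] word_prob_posD[OF s(2)] by simp
  qed
  then obtain a where "0 < word_prob M W (w @ s @ [a])" by auto
  with s show ?case by (intro exI[of _ "s @ [a]"]) simp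
qed

lemma prob_shifted_window:
  assumes "set w \<subseteq> S"
  shows "\<P>(\<omega> in M. window W 1 (Suc (length w)) \<omega> = w) = (\<Sum>a\<in>S. word_prob M W (a # w))"
proof -
  have "\<P>(\<omega> in M. window W 1 (Suc (length w)) \<omega> = w)
      = \<P>(\<omega> in M. tl (window W 0 (Suc (length w)) \<omega>) = w)"
    by (simp add: tl_window)
  also have "\<dots> = (\<Sum>v | v \<in> words S (Suc (length w)) \<and> tl v = w. word_prob M W v)"
    by (rule sum_word_prob)
  also have "\<dots> = (\<Sum>a\<in>S. word_prob M W (a # w))"
    using assms finite_S by (intro sum_over_heads) auto
  finally show ?thesis .
qed

text \<open>
  By \<open>prob_shifted_window\<close>, the sum is the probability of reading \<open>w\<close> at time 1, so
  this is invariance under the shift by one, and hence stationarity in the usual sense.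
\<close>

definition stationary :: bool where
  "stationary \<longleftrightarrow> (\<forall>w. set w \<subseteq> S \<longrightarrow> (\<Sum>a\<in>S. word_prob M W (a # w)) = word_prob M W w)"

text \<open>
  In the terminology of symbolic dynamics: the words of positive probability form an irreducible
  language.
\<close>

definition irreducible_language :: bool where
  "irreducible_language \<longleftrightarrow>
     (\<forall>u v. 0 < word_prob M W u \<longrightarrow> 0 < word_prob M W v \<longrightarrow> (\<exists>c. 0 < word_prob M W (u @ c @ v)))"

lemma word_prob_suffix_pos:
  assumes "stationary"
  shows "0 < word_prob M W (u @ v) \<Longrightarrow> 0 < word_prob M W v"
proof (induction u)
  case (Cons a u)
  have S: "a \<in> S" "set (u @ v) \<subseteq> S" using word_prob_posD[OF Cons.prems] by auto
  have "word_prob M W (a # u @ v) \<le> (\<Sum>a\<in>S. word_prob M W (a # u @ v))"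
    using S finite_S word_prob_nonneg
    by (intro member_le_sum[where f = "\<lambda>a. word_prob M W (a # u @ v)"]) auto
  also have "\<dots> = word_prob M W (u @ v)"
    using assms S unfolding stationary_def by blast
  finally show ?case using Cons by simp
qed simp

text \<open>
  The probability of a short word is the sum of those of its extensions by one letter, so the
  shift identity descends from each length to the next smaller one. For a Markov chain, only words
  at least as long as the order are directly controlled.
\<close>

lemma stationary_if_long_words:
  assumes "\<And>w. set w \<subseteq> S \<Longrightarrow> n \<le> length w \<Longrightarrow>
             (\<Sum>a\<in>S. word_prob M W (a # w)) = word_prob M W w"
  shows "stationary"
proof -
  have "(\<Sum>a\<in>S. word_prob M W (a # w)) = word_prob M W w" if "set w \<subseteq> S" for w
    using that
  proof (induction "n - length w" arbitrary: w)
    case 0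
    then show ?case using assms by simp
  next
    case (Suc m)
    have IH: "(\<Sum>a\<in>S. word_prob M W (a # w @ [b])) = word_prob M W (w @ [b])" if "b \<in> S" for b
      using Suc.hyps(1)[of "w @ [b]"] Suc.hyps(2) Suc.prems that by simp
    have "(\<Sum>a\<in>S. word_prob M W (a # w)) = (\<Sum>a\<in>S. \<Sum>b\<in>S. word_prob M W ((a # w) @ [b]))"
      using Suc.prems by (intro sum.cong refl sum_word_prob_snoc[symmetric]) auto
    also have "\<dots> = (\<Sum>b\<in>S. \<Sum>a\<in>S. word_prob M W (a # w @ [b]))"
      by (subst sum.swap) simp
    also have "\<dots> = (\<Sum>b\<in>S. word_prob M W (w @ [b]))"
      using IH by simp
    also have "\<dots> = word_prob M W w"
      using Suc.prems by (rule sum_word_prob_snoc)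
    finally show ?case .
  qed
  then show ?thesis by (simp add: stationary_def)
qed

end

section \<open>Stationary Markov chains\<close>

locale stationary_markov_chain =
  fixes M :: "'a measure" and l :: nat and S :: "'z set" and W :: "nat \<Rightarrow> 'a \<Rightarrow> 'z"
    and P :: "'z list \<Rightarrow> 'z \<Rightarrow> real" and \<pi> :: "'z list pmf"
  assumes finite_alphabet: "finite S"
    and order_pos: "l \<ge> 1"
    and markov: "homogeneous_markov_chain M l S W P"
    and pi_invariant: "invariant_distribution_first_order (words S l) (lifted_transition P) \<pi>"
    and initial: "\<And>w. w \<in> words S l \<Longrightarrow> \<P>(\<omega> in M. window W 0 l \<omega> = w) = pmf \<pi> w"
begin

sublocale finite_alphabet_process M S W
  using markov finite_alphabet
  by (auto simp: homogeneous_markov_chain_def finite_alphabet_process_def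
      finite_alphabet_process_axioms_def)

sublocale lifted: finite_stochastic_matrix "words S l" "lifted_transition P"
  using markov finite_alphabet order_pos
  by (intro finite_stochastic_matrix_lifted) (auto simp: homogeneous_markov_chain_def)

lemma word_prob_initial: "w \<in> words S l \<Longrightarrow> word_prob M W w = pmf \<pi> w"
  using initial by (auto simp: word_prob_def)

lemma word_prob_snoc:
  assumes "set w \<subseteq> S" "l \<le> length w" "a \<in> S"
  shows "word_prob M W (w @ [a]) = word_prob M W w * P (drop (length w - l) w) a"
proof (cases "0 < word_prob M W w")
  case False
  then have "word_prob M W w = 0" "word_prob M W (w @ [a]) = 0"
    using word_prob_nonneg[of w] word_prob_nonneg[of "w @ [a]"] word_prob_prefix[of w "[a]"]
    by linarith+
  then show ?thesis by simp
next
  case True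
  let ?n = "length w"
  have "\<P>(\<omega> in M. W ?n \<omega> = a \<bar> window W 0 ?n \<omega> = w) = P (drop (?n - l) w) a"
    using markov assms True unfolding homogeneous_markov_chain_def word_prob_def by auto
  moreover have "\<P>(\<omega> in M. W ?n \<omega> = a \<and> window W 0 ?n \<omega> = w) = word_prob M W (w @ [a])"
    unfolding word_prob_def by (simp add: window_Suc length_window conj_commute)
  ultimately show ?thesis
    using True by (simp add: cond_prob_def word_prob_def field_simps)
qed

text \<open>
  For words of length \<open>l\<close> the shift identity is the invariance equation of \<open>\<pi>\<close>. It persists for longer
  words because the factor gained by appending a letter depends only on the last \<open>l\<close> letters,
  which are the same with and without an additional first letter.
\<close>

lemma is_stationary: "stationary"
proof (rule stationary_if_long_words[of l])
  fix w assume "set w \<subseteq> S" "l \<le> length w"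
  then show "(\<Sum>a\<in>S. word_prob M W (a # w)) = word_prob M W w"
  proof (induction w rule: rev_induct)
    case Nil
    with order_pos show ?case by simp
  next
    case (snoc b w)
    show ?case
    proof (cases "l \<le> length w")
      case True
      have "(\<Sum>a\<in>S. word_prob M W (a # w @ [b]))
          = (\<Sum>a\<in>S. word_prob M W (a # w) * P (drop (length w - l) w) b)"
        using snoc.prems True word_prob_snoc[of "_ # w" b]
        by (intro sum.cong) (auto simp: Suc_diff_le)
      also have "\<dots> = word_prob M W w * P (drop (length w - l) w) b"
        using snoc True by (simp add: sum_distrib_right[symmetric])
      also have "\<dots> = word_prob M W (w @ [b])"
        using snoc.prems True by (simp add: word_prob_snoc)
      finally show ?thesis .
    next
      case False
      then have l: "l = Suc (length w)" using snoc.prems by simp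
      have inv: "invariant_distribution l S P \<pi>"
        using pi_invariant finite_alphabet order_pos invariant_distribution_iff_lifted by blast
      have "(\<Sum>a\<in>S. word_prob M W (a # w @ [b]))
          = (\<Sum>a\<in>S. pmf \<pi> (a # w) * P (a # w) b)"
        using snoc.prems l word_prob_snoc[of "_ # w" b]
        by (intro sum.cong) (auto simp: word_prob_initial)
      also have "\<dots> = pmf \<pi> (w @ [b])"
        using inv snoc.prems l by (auto simp: invariant_distribution_def)
      also have "\<dots> = word_prob M W (w @ [b])"
        using snoc.prems l by (subst word_prob_initial) auto
      finally show ?thesis .
    qed
  qed
qed

text \<open>
  The Markov property in the form of a gluing rule: an overlap \<open>z\<close> as long as the order of the
  chain decouples what precedes it from what follows.
\<close>

lemma word_prob_glue:
  assumes "length z = l" "0 < word_prob M W (x @ z)"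
  shows "0 < word_prob M W (z @ r) \<Longrightarrow> 0 < word_prob M W (x @ z @ r)"
proof (induction r rule: rev_induct)
  case Nil
  with assms show ?case by simp
next
  case (snoc a r)
  have zr: "0 < word_prob M W (z @ r)"
    using word_prob_prefix_pos[of "z @ r" "[a]"] snoc.prems by simp
  then have xzr: "0 < word_prob M W (x @ z @ r)" by (rule snoc.IH)
  have a: "a \<in> S" using word_prob_posD[OF snoc.prems] by simp
  let ?p = "P (drop (length r) (z @ r)) a"
  have "word_prob M W (z @ r @ [a]) = word_prob M W (z @ r) * ?p"
    using word_prob_snoc[of "z @ r" a] word_prob_posD[OF zr] a assms(1) by simp
  with zr snoc.prems have "0 < ?p" by (simp add: zero_less_mult_iff)
  moreover have "word_prob M W (x @ z @ r @ [a]) = word_prob M W (x @ z @ r) * ?p"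
    using word_prob_snoc[of "x @ z @ r" a] word_prob_posD[OF xzr] a assms(1) by simp
  ultimately show ?case using xzr by simp
qed

lemma positive_path_extends_word:
  assumes "(s, z) \<in> lifted.positive_steps\<^sup>*" "length s = l" "0 < word_prob M W (x @ s)"
  shows "\<exists>c. length z = l \<and> 0 < word_prob M W (x @ c @ z)"
  using assms(1)
proof (induction rule: rtrancl_induct)
  case base
  show ?case using assms(2,3) by (intro exI[of _ "[]"]) simp
next
  case (step z z')
  then obtain c where c: "length z = l" "0 < word_prob M W (x @ c @ z)" by blast
  from step(2) have zz: "z' \<in> words S l" "0 < lifted_transition P z z'"
    by (auto simp: lifted.positive_steps_def)
  from zz(2) have trans: "tl z = butlast z'" "0 < P z (last z')"
    by (auto simp: lifted_transition_def split: if_splits)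
  have ne: "z' \<noteq> []" "z \<noteq> []" using zz(1) c(1) order_pos by auto
  have "last z' \<in> S" using zz(1) ne last_in_set[of z'] by auto
  then have "word_prob M W (x @ c @ z @ [last z']) = word_prob M W (x @ c @ z) * P z (last z')"
    using word_prob_snoc[of "x @ c @ z" "last z'"] word_prob_posD[OF c(2)] c(1) by simp
  moreover have "z @ [last z'] = hd z # z'"
    using ne trans(1) by (metis append_Cons append_butlast_last_id list.collapse)
  ultimately have "0 < word_prob M W (x @ (c @ [hd z]) @ z')"
    using c(2) trans(2) by simp
  with zz(1) show ?case by blast
qed

text \<open>
  After extending \<open>u\<close> by a word \<open>s\<close> of length \<open>l\<close>, and \<open>v\<close> to a word of length at least \<open>l\<close> with initial
  part \<open>z\<close> of length \<open>l\<close>, both \<open>s\<close> and \<open>z\<close> lie in the support of \<open>\<pi>\<close>. A path from \<open>s\<close> to \<open>z\<close> spells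
  out a positive continuation of \<open>us\<close> ending in \<open>z\<close>, to which the rest of the extension of \<open>v\<close> is glued.
  As \<open>s\<close> and \<open>z\<close> have the same length, \<open>z\<close> starts no earlier than the end of \<open>u\<close>.
\<close>

lemma irreducible_if_unique:
  assumes unique: "\<And>\<pi>'. invariant_distribution_first_order (words S l) (lifted_transition P) \<pi>'
                     \<Longrightarrow> \<pi>' = \<pi>"
  shows "irreducible_language"
  unfolding irreducible_language_def
proof (intro allI impI)
  fix u v assume u: "0 < word_prob M W u" and v: "0 < word_prob M W v"
  obtain s where s: "length s = l" "0 < word_prob M W (u @ s)"
    using extend_word_pos[OF u] by blast
  obtain r where r: "length r = l" "0 < word_prob M W (v @ r)"
    using extend_word_pos[OF v] by blast
  define z t where "z = take l (v @ r)" and "t = drop l (v @ r)"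
  have zt: "z @ t = v @ r" and len_z: "length z = l" using r(1) unfolding z_def t_def by (simp_all only: append_take_drop_id) simp
  have "0 < word_prob M W s" using word_prob_suffix_pos[OF is_stationary s(2)] .
  moreover have "0 < word_prob M W z" using word_prob_prefix_pos[of z t] zt r(2) by simp
  ultimately have "s \<in> set_pmf \<pi>" "z \<in> set_pmf \<pi>"
    using word_prob_posD s(1) len_z word_prob_initial[of s] word_prob_initial[of z]
    by (auto simp: set_pmf_iff)
  then have "(s, z) \<in> lifted.positive_steps\<^sup>*"
    using lifted.support_strongly_connected[OF pi_invariant unique] by blast
  then obtain c where "0 < word_prob M W (u @ c @ z)"
    using positive_path_extends_word s by blast
  then have "0 < word_prob M W ((u @ c) @ z @ t)"
    using len_z r(2) zt by (intro word_prob_glue) auto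
  then have "0 < word_prob M W ((u @ c @ v) @ r)" using zt by simp
  then show "\<exists>c. 0 < word_prob M W (u @ c @ v)" by (blast dest: word_prob_prefix_pos)
qed

end

section \<open>Letterwise images of a process\<close>

locale lumped_process = finite_alphabet_process M A X
  for M :: "'a measure" and A :: "'x set" and X :: "nat \<Rightarrow> 'a \<Rightarrow> 'x" +
  fixes B :: "'y set" and g :: "'x \<Rightarrow> 'y" and Y :: "nat \<Rightarrow> 'a \<Rightarrow> 'y"
  assumes finite_B: "finite B"
    and g_maps: "g \<in> A \<rightarrow> B"
    and Y_eq: "\<And>n \<omega>. \<omega> \<in> space M \<Longrightarrow> Y n \<omega> = g (X n \<omega>)"
begin

lemma Y_measurable: "Y n \<in> measurable M (count_space B)"
proof -
  have "(\<lambda>\<omega>. g (X n \<omega>)) \<in> measurable M (count_space B)"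
    using g_maps by (intro measurable_compose[OF W_measurable]) simp
  then show ?thesis using Y_eq by (subst measurable_cong) auto
qed

sublocale image: finite_alphabet_process M B Y
  by unfold_locales (auto simp: finite_B Y_measurable)

lemma window_image: "\<omega> \<in> space M \<Longrightarrow> window Y m n \<omega> = map g (window X m n \<omega>)"
  by (simp add: window_def Y_eq)

lemma prob_image_window:
  "\<P>(\<omega> in M. window Y m n \<omega> = v)
     = (\<Sum>w | w \<in> words A (n - m) \<and> map g w = v. \<P>(\<omega> in M. window X m n \<omega> = w))"
proof -
  have "{\<omega> \<in> space M. window Y m n \<omega> = v} = {\<omega> \<in> space M. map g (window X m n \<omega>) = v}"
    by (auto simp: window_image)
  then show ?thesis using window_prob_sum[of "\<lambda>w. map g w = v" m n] by simp
qed

lemma word_prob_image: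
  "word_prob M Y v = (\<Sum>w | w \<in> words A (length v) \<and> map g w = v. word_prob M X w)"
  unfolding word_prob_def prob_image_window by (auto intro!: sum.cong)

lemma image_stationary:
  assumes "stationary"
  shows "image.stationary"
  unfolding image.stationary_def
proof (intro allI impI)
  fix v assume v: "set v \<subseteq> B"
  have "(\<Sum>b\<in>B. word_prob M Y (b # v)) = \<P>(\<omega> in M. window Y 1 (Suc (length v)) \<omega> = v)"
    using image.prob_shifted_window[OF v] by simp
  also have "\<dots> = (\<Sum>w | w \<in> words A (length v) \<and> map g w = v.
                     \<P>(\<omega> in M. window X 1 (Suc (length v)) \<omega> = w))"
    by (subst prob_image_window) simp
  also have "\<dots> = (\<Sum>w | w \<in> words A (length v) \<and> map g w = v. word_prob M X w)"
    using prob_shifted_window assms unfolding stationary_def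
    by (intro sum.cong) auto
  also have "\<dots> = word_prob M Y v" by (simp add: word_prob_image)
  finally show "(\<Sum>b\<in>B. word_prob M Y (b # v)) = word_prob M Y v" .
qed

lemma image_word_pos_iff: "0 < word_prob M Y v \<longleftrightarrow> (\<exists>w. map g w = v \<and> 0 < word_prob M X w)"
proof
  assume pos: "0 < word_prob M Y v"
  show "\<exists>w. map g w = v \<and> 0 < word_prob M X w"
  proof (rule ccontr)
    assume "\<not> ?thesis"
    then have "word_prob M Y v \<le> 0"
      unfolding word_prob_image by (intro sum_nonpos) (auto simp: not_less)
    with pos show False by simp
  qed
next
  assume "\<exists>w. map g w = v \<and> 0 < word_prob M X w"
  then obtain w where w: "map g w = v" "0 < word_prob M X w" by blast
  then have "word_prob M X w \<le> word_prob M Y v"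
    unfolding word_prob_image using word_prob_posD[OF w(2)] word_prob_nonneg
    by (intro member_le_sum finite_words_Collect[OF finite_S]) auto
  with w show "0 < word_prob M Y v" by simp
qed

lemma image_irreducible:
  assumes "irreducible_language"
  shows "image.irreducible_language"
  unfolding image.irreducible_language_def
proof (intro allI impI)
  fix u v assume "0 < word_prob M Y u" "0 < word_prob M Y v"
  then obtain x y where "map g x = u" "map g y = v" "0 < word_prob M X x" "0 < word_prob M X y"
    by (auto simp: image_word_pos_iff)
  moreover from this assms obtain c where "0 < word_prob M X (x @ c @ y)"
    unfolding irreducible_language_def by blast
  ultimately have "\<exists>w. map g w = u @ map g c @ v \<and> 0 < word_prob M X w"
    by (intro exI[of _ "x @ c @ y"]) simp
  then show "\<exists>c. 0 < word_prob M Y (u @ c @ v)"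
    unfolding image_word_pos_iff by blast
qed

end

section \<open>The Markov approximation of a stationary process\<close>

locale approximated_process = finite_alphabet_process M B Y
  for M :: "'a measure" and B :: "'y set" and Y :: "nat \<Rightarrow> 'a \<Rightarrow> 'y" +
  fixes k :: nat and Q :: "'y list \<Rightarrow> 'y \<Rightarrow> real"
  assumes k_pos: "k \<ge> 1"
    and Q_stochastic: "row_stochastic k B Q"
    and Y_stationary: "stationary"
    and Q_eq: "\<And>w a. w \<in> words B k \<Longrightarrow> a \<in> B \<Longrightarrow>
       Q w a = (if 0 < word_prob M Y w then word_prob M Y (w @ [a]) / word_prob M Y w
                else 1 / card B)"
begin

sublocale lifted: finite_stochastic_matrix "words B k" "lifted_transition Q"
  using finite_S k_pos Q_stochastic by (rule finite_stochastic_matrix_lifted)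

text \<open>
  Both sides vanish on words of probability zero. Summed over the first letter of \<open>w\<close>, the identity
  becomes the invariance equation for the law of the first \<open>k\<close> letters.
\<close>

lemma word_prob_times_transition:
  assumes "w \<in> words B k" "a \<in> B"
  shows "word_prob M Y w * Q w a = word_prob M Y (w @ [a])"
proof (cases "0 < word_prob M Y w")
  case True
  then show ?thesis using Q_eq[OF assms] by simp
next
  case False
  then show ?thesis
    using word_prob_nonneg[of w] word_prob_nonneg[of "w @ [a]"] word_prob_prefix[of w "[a]"]
    by (simp add: not_less)
qed

text \<open>
  The invariant distribution is the law of \<open>window Y 0 k\<close>, as a probability mass function.
\<close>

lemma invariant_distribution_exists: "\<exists>\<mu>. invariant_distribution k B Q \<mu>"
proof -
  define f where "f = (\<lambda>w. if w \<in> words B k then word_prob M Y w else 0)"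
  have "(\<Sum>w\<in>words B k. word_prob M Y w) = \<P>(\<omega> in M. True)"
    using sum_word_prob[of "\<lambda>_. True" k] by simp
  then have total: "(\<Sum>w\<in>words B k. f w) = 1"
    by (simp add: f_def prob_space)
  have f_nonneg: "0 \<le> f w" for w by (simp add: f_def word_prob_nonneg)
  have "(\<integral>\<^sup>+w. ennreal (f w) \<partial>count_space UNIV) = (\<Sum>w\<in>words B k. ennreal (f w))"
    using lifted.finite_S by (intro nn_integral_count_space') (auto simp: f_def)
  also have "\<dots> = 1"
    using total f_nonneg by (simp add: sum_ennreal)
  finally have pmf_f: "pmf (embed_pmf f) w = f w" for w
    using f_nonneg by (intro pmf_embed_pmf)
  have "invariant_distribution k B Q (embed_pmf f)"
    unfolding invariant_distribution_def
  proof (intro conjI ballI)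
    show "set_pmf (embed_pmf f) \<subseteq> words B k"
    proof
      fix w assume "w \<in> set_pmf (embed_pmf f)"
      then have "f w \<noteq> 0" by (simp only: set_pmf_iff pmf_f not_False_eq_True)
      then show "w \<in> words B k" unfolding f_def by argo
    qed
    fix w assume w: "w \<in> words B k"
    obtain n where k: "k = Suc n" using k_pos by (cases k) auto
    have w': "butlast w \<in> words B n" "last w \<in> B" "w \<noteq> []"
      using w k butlast_in_words[of w B n] by (cases w rule: rev_cases; auto)+
    have "pmf (embed_pmf f) w = word_prob M Y w" unfolding pmf_f using w by (simp add: f_def)
    also have "\<dots> = (\<Sum>a\<in>B. word_prob M Y (a # w))"
      using Y_stationary w by (simp add: stationary_def)
    also have "\<dots> = (\<Sum>a\<in>B. f (a # butlast w) * Q (a # butlast w) (last w))"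
    proof (intro sum.cong refl)
      fix a assume "a \<in> B"
      then have aw: "a # butlast w \<in> words B k" using w' k by simp
      then have "f (a # butlast w) = word_prob M Y (a # butlast w)"
        unfolding f_def by (rule if_P)
      then show "word_prob M Y (a # w) = f (a # butlast w) * Q (a # butlast w) (last w)"
        using word_prob_times_transition[OF aw w'(2)] w'(3) by simp
    qed
    finally show "pmf (embed_pmf f) w = (\<Sum>a\<in>B. pmf (embed_pmf f) (a # butlast w)
                                                * Q (a # butlast w) (last w))"
      by (simp add: pmf_f)
  qed
  then show ?thesis ..
qed

lemma lifted_step:
  assumes "w \<in> words B k" "a \<in> B" "0 < Q w a"
  shows "(w, tl w @ [a]) \<in> lifted.positive_steps"
proof -
  have "tl w @ [a] \<in> words B k"
    using assms(1,2) k_pos by (cases w) auto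
  with assms show ?thesis
    by (simp add: lifted.positive_steps_def lifted_transition_def)
qed

text \<open>
  The path is that of a window of length \<open>k\<close> sliding along \<open>u @ t\<close>. By stationarity, all factors of
  a word of positive probability have positive probability, so each move has a positive entry in \<open>Q\<close>.
\<close>

lemma positive_word_gives_path:
  assumes "length u = k"
  shows "0 < word_prob M Y (u @ t)
           \<Longrightarrow> (u, drop (length t) (u @ t)) \<in> lifted.positive_steps\<^sup>*"
proof (induction t rule: rev_induct)
  case (snoc a t)
  define w where "w = drop (length t) (u @ t)"
  have split: "u @ t = take (length t) (u @ t) @ w"
    unfolding w_def by (rule append_take_drop_id[symmetric])
  have "0 < word_prob M Y (take (length t) (u @ t) @ w @ [a])"
    using snoc.prems split by (metis append.assoc)
  then have wa: "0 < word_prob M Y (w @ [a])"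
    by (rule word_prob_suffix_pos[OF Y_stationary])
  have w: "w \<in> words B k" "a \<in> B"
    using word_prob_posD[OF wa] assms by (auto simp: w_def)
  have pos: "0 < word_prob M Y w"
    using wa by (rule word_prob_prefix_pos)
  with wa Q_eq[OF w] have "0 < Q w a" by simp
  then have "(w, tl w @ [a]) \<in> lifted.positive_steps" using w by (intro lifted_step)
  moreover have "(u, w) \<in> lifted.positive_steps\<^sup>*"
    using snoc.IH snoc.prems word_prob_prefix_pos[of "u @ t" "[a]"] by (simp add: w_def)
  moreover have "drop (length (t @ [a])) (u @ t @ [a]) = tl w @ [a]"
  proof -
    have "drop (length (t @ [a])) (u @ t @ [a]) = drop 1 (drop (length t) ((u @ t) @ [a]))"
      by (simp only: drop_drop append_assoc) simp
    also have "\<dots> = drop 1 (w @ [a])" by (simp add: w_def)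
    also have "\<dots> = tl w @ [a]" using w(1) k_pos by (cases w) auto
    finally show ?thesis .
  qed
  ultimately show ?case by simp
qed (use assms in simp)

text \<open>
  As long as only words of probability zero are met, their uniform rows permit appending the letters
  of \<open>v\<close> in order; after \<open>k\<close> steps the current word would be \<open>v\<close>, which has positive probability.
\<close>

lemma reaches_positive_word:
  assumes u: "u \<in> words B k" and v: "v \<in> words B k" "0 < word_prob M Y v"
  shows "\<exists>w\<in>words B k. 0 < word_prob M Y w \<and> (u, w) \<in> lifted.positive_steps\<^sup>*"
proof (rule ccontr)
  assume contra: "\<not> ?thesis"
  have "(u, drop i u @ take i v) \<in> lifted.positive_steps\<^sup>*" if "i \<le> k" for i
    using that
  proof (induction i)
    case (Suc i)
    let ?w = "drop i u @ take i v"
    have w: "?w \<in> words B k"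
      using u v(1) Suc.prems by (auto dest: in_set_dropD in_set_takeD)
    have a: "v ! i \<in> B" using v(1) Suc.prems by auto
    have "\<not> 0 < word_prob M Y ?w" using contra w Suc by auto
    moreover have "0 < card B" using a finite_S by (auto simp: card_gt_0_iff)
    ultimately have "0 < Q ?w (v ! i)" using Q_eq[OF w a] by simp
    then have "(?w, tl ?w @ [v ! i]) \<in> lifted.positive_steps" using w a by (intro lifted_step)
    moreover have "tl ?w @ [v ! i] = drop (Suc i) u @ take (Suc i) v"
      using u v(1) Suc.prems by (simp add: take_Suc_conv_app_nth drop_Suc tl_drop)
    ultimately show ?case using Suc by auto
  qed simp
  from this[of k] have "(u, v) \<in> lifted.positive_steps\<^sup>*" using u v(1) by simp
  with contra v show False by blast
qed

lemma unique_invariant_distribution_if_irreducible: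
  assumes "irreducible_language"
  shows "\<exists>!\<mu>. invariant_distribution k B Q \<mu>"
proof (rule ex_ex1I[OF invariant_distribution_exists])
  have "0 < word_prob M Y []"
    by (simp add: word_prob_def window_def prob_space)
  then obtain v where v: "length v = k" "0 < word_prob M Y v"
    using extend_word_pos[of "[]" k] by auto
  then have v_in: "v \<in> words B k" using word_prob_posD by simp
  have root: "(u, v) \<in> lifted.positive_steps\<^sup>*" if "u \<in> words B k" for u
  proof -
    obtain w where w: "w \<in> words B k" "0 < word_prob M Y w" "(u, w) \<in> lifted.positive_steps\<^sup>*"
      using reaches_positive_word[OF \<open>u \<in> words B k\<close> v_in v(2)] by blast
    obtain c where "0 < word_prob M Y (w @ c @ v)"
      using assms w(2) v(2) unfolding irreducible_language_def by blast
    then have "(w, drop (length (c @ v)) (w @ c @ v)) \<in> lifted.positive_steps\<^sup>*"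
      using w(1) by (intro positive_word_gives_path) auto
    moreover have "drop (length (c @ v)) (w @ c @ v) = v" using w(1) v(1) by simp
    ultimately show ?thesis using w(3) by simp
  qed
  show "\<mu> = \<nu>" if "invariant_distribution k B Q \<mu>" "invariant_distribution k B Q \<nu>" for \<mu> \<nu>
    using that lifted.invariant_distribution_first_order_unique[OF root]
    by (simp add: invariant_distribution_iff_lifted[OF finite_S k_pos])
qed

end

section \<open>Uniqueness for the approximation of a lumped chain\<close>

theorem corollary1:
  fixes k l :: nat
    and A :: "'x set" and B :: "'y set"
    and M :: "'a measure" and X :: "nat \<Rightarrow> 'a \<Rightarrow> 'x" and P :: "'x list \<Rightarrow> 'x \<Rightarrow> real"
    and \<pi> :: "'x list pmf"
    and g :: "'x \<Rightarrow> 'y" and Y :: "nat \<Rightarrow> 'a \<Rightarrow> 'y"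
    and N :: "'b measure" and Z :: "nat \<Rightarrow> 'b \<Rightarrow> 'y" and Q :: "'y list \<Rightarrow> 'y \<Rightarrow> real"
  assumes "k \<ge> 1" and "l \<ge> 1"
    and "finite A" and "finite B"
    and "homogeneous_markov_chain M l A X P"
    and "\<exists>!C. C \<in> recurrent_classes (words A l) (lifted_transition P)"
    and "invariant_distribution_first_order (words A l) (lifted_transition P) \<pi>"
    and "\<And>\<pi>'. invariant_distribution_first_order (words A l) (lifted_transition P) \<pi>' \<Longrightarrow> \<pi>' = \<pi>"
    and "\<And>w. w \<in> words A l \<Longrightarrow> \<P>(\<omega> in M. window X 0 l \<omega> = w) = pmf \<pi> w"
    and "g \<in> A \<rightarrow> B"
    and "\<And>n \<omega>. \<omega> \<in> space M \<Longrightarrow> Y n \<omega> = g (X n \<omega>)"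
    and "markov_approximation M Y k B N Z Q"
  shows "\<exists>!\<mu>. invariant_distribution k B Q \<mu>"
proof -
  interpret X: stationary_markov_chain M l A X P \<pi>
    using assms(2,3,5,7,9) by unfold_locales
  interpret Y: lumped_process M A X B g Y
    using assms(4,10,11) by unfold_locales
  interpret Z: approximated_process M B Y k Q
  proof unfold_locales
    show "k \<ge> 1" by fact
    show "row_stochastic k B Q"
      using assms(12) by (simp add: markov_approximation_def homogeneous_markov_chain_def)
    show "Y.image.stationary"
      using X.is_stationary by (rule Y.image_stationary)
    show "Q w a = (if 0 < word_prob M Y w then word_prob M Y (w @ [a]) / word_prob M Y w
                   else 1 / card B)" if "w \<in> words B k" "a \<in> B" for w a
      using assms(12) that by (auto simp: markov_approximation_def word_prob_def)
  qed
  show ?thesis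
    using X.irreducible_if_unique assms(8)
    by (intro Z.unique_invariant_distribution_if_irreducible Y.image_irreducible) blast
qed

end
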